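(* Let $G$ be a connected graph with $|V(G)| \ge 3$. Then $\det'(G) = \det(L(G))$ if and only if $G \notin \{G_1, G_2, G_3\}$, where $G_1,G_2,G_3$ are the following graphs on vertex set $\{1,2,3,4\}$: $G_1$ has edges $\{1,2\},\{2,3\},\{2,4\},\{3,4\}$; $G_2$ has edges $\{1,2\},\{2,3\},\{3,4\},\{1,3\},\{2,4\}$; $G_3 = K_4$.
   Context: All graphs are finite and simple. An automorphism of $G$ is an adjacency-preserving bijection of $V(G)$; $\mathrm{Aut}(G)$ is the automorphism group. A vertex subset $S$ is a vertex determining set if the only automorphism fixing every vertex of $S$ is the identity; the determining number $\det(G)$ is the minimum size of a vertex determining set. For a graph $G$ with at most one isolated vertex and no component isomorphic to $K_2$, an edge subset $T$ is an edge determining set if the only $\phi\in\mathrm{Aut}(G)$ satisfying $\{\phi(u),\phi(v)\}=\{u,v\}$ for all $\{u,v\}\in T$ is the identity; the determining index $\det'(G)$ is the minimum size of an edge determining set. $L(G)$ denotes the line graph of $G$: its vertices are the edges of $G$, two being adjacent when they share an endvertex. *)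

theory Defs
  imports Main
begin

text \<open>A finite simple graph is a pair (V, E): V a finite vertex set, E a set of
2-element subsets of V.\<close>

definition simple_graph :: "'a set \<Rightarrow> 'a set set \<Rightarrow> bool" where
  "simple_graph V E \<longleftrightarrow> finite V \<and> (\<forall>e\<in>E. e \<subseteq> V \<and> card e = 2)"

definition connected_graph :: "'a set \<Rightarrow> 'a set set \<Rightarrow> bool" where
  "connected_graph V E \<longleftrightarrow> V \<noteq> {} \<and>
     (\<forall>u\<in>V. \<forall>v\<in>V. (u, v) \<in> ({(x, y). {x, y} \<in> E})\<^sup>*)"

text \<open>Automorphisms: adjacency-preserving bijections of V (only their values on V matter).\<close>

definition aut :: "'a set \<Rightarrow> 'a set set \<Rightarrow> ('a \<Rightarrow> 'a) set" where
  "aut V E = {f. bij_betw f V V \<and> (\<forall>u\<in>V. \<forall>v\<in>V. {u, v} \<in> E \<longleftrightarrow> {f u, f v} \<in> E)}"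

definition vertex_determining :: "'a set \<Rightarrow> 'a set set \<Rightarrow> 'a set \<Rightarrow> bool" where
  "vertex_determining V E S \<longleftrightarrow> S \<subseteq> V \<and>
     (\<forall>f\<in>aut V E. (\<forall>x\<in>S. f x = x) \<longrightarrow> (\<forall>x\<in>V. f x = x))"

definition determining_number :: "'a set \<Rightarrow> 'a set set \<Rightarrow> nat" where
  "determining_number V E = (LEAST n. \<exists>S. vertex_determining V E S \<and> card S = n)"

definition edge_determining :: "'a set \<Rightarrow> 'a set set \<Rightarrow> 'a set set \<Rightarrow> bool" where
  "edge_determining V E T \<longleftrightarrow> T \<subseteq> E \<and>
     (\<forall>f\<in>aut V E. (\<forall>e\<in>T. f ` e = e) \<longrightarrow> (\<forall>x\<in>V. f x = x))"

definition determining_index :: "'a set \<Rightarrow> 'a set set \<Rightarrow> nat" where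
  "determining_index V E = (LEAST n. \<exists>T. edge_determining V E T \<and> card T = n)"

text \<open>Line graph: vertices are the edges of G, adjacent iff distinct and sharing an endvertex.\<close>

definition line_graph_edges :: "'a set set \<Rightarrow> 'a set set set" where
  "line_graph_edges E = {{e, e'} | e e'. e \<in> E \<and> e' \<in> E \<and> e \<noteq> e' \<and> e \<inter> e' \<noteq> {}}"

definition graph_iso :: "'a set \<Rightarrow> 'a set set \<Rightarrow> 'b set \<Rightarrow> 'b set set \<Rightarrow> bool" where
  "graph_iso V E W F \<longleftrightarrow> (\<exists>f. bij_betw f V W \<and>
     (\<forall>u\<in>V. \<forall>v\<in>V. {u, v} \<in> E \<longleftrightarrow> {f u, f v} \<in> F))"

definition G1_edges :: "nat set set" where
  "G1_edges = {{1,2},{2,3},{2,4},{3,4}}"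
definition G2_edges :: "nat set set" where
  "G2_edges = {{1,2},{2,3},{3,4},{1,3},{2,4}}"
definition G3_edges :: "nat set set" where
  "G3_edges = {{1,2},{1,3},{1,4},{2,3},{2,4},{3,4}}"

end

(* A triple of pairwise adjacent edges is either a claw (three edges at one vertex) or a triangle.
   Every edge outside a triangle meets an even number of its sides, whereas in a connected graph
   a claw with the same parity property spans the whole graph, which then is K_{1,3}, G1, G2 or G3.
   Parity is visible in the line graph, so outside the exceptions every automorphism of L(G) maps
   claws to claws, hence stars to stars, and is therefore induced by an automorphism of G
   (Whitney). Then edge determining sets of G and determining sets of L(G) are the same sets.
   In G1, G2, G3 the line graph has 2, 2, 3 disjoint pairs of twin vertices, each of which must
   meet every determining set of L(G), while 1, 1, 2 edges suffice to determine G. *)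
theory Submission
  imports Defs "HOL-Combinatorics.Transposition"
begin

section \<open>Simple graphs and isomorphisms\<close>

lemma simple_graph_edge:
  assumes "simple_graph V E" "e \<in> E"
  shows "\<exists>u v. e = {u, v} \<and> u \<noteq> v \<and> u \<in> V \<and> v \<in> V"
proof -
  have "e \<subseteq> V" "card e = 2" using assms unfolding simple_graph_def by blast+
  then show ?thesis by (auto simp: card_2_iff)
qed

lemma simple_graph_other_end:
  assumes "simple_graph V E" "e \<in> E" "v \<in> e"
  shows "\<exists>u. u \<in> V \<and> u \<noteq> v \<and> e = {v, u}"
  using simple_graph_edge[OF assms(1,2)] assms(3) by auto

text \<open>The hypothesis on \<open>F\<close> suits explicit finite edge sets. Edges lie inside
  \<open>V\<close>, where \<open>f\<close> is injective, so a pair whose image is the image of an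
  edge is itself that edge.\<close>

lemma graph_isoI:
  assumes f: "bij_betw f V W" and E: "\<Union>E \<subseteq> V" and F: "F = (`) f ` E"
  shows "graph_iso V E W F"
  unfolding graph_iso_def
proof (intro exI conjI ballI)
  have inj: "inj_on f V" using f by (rule bij_betw_imp_inj_on)
  fix u v assume uv: "u \<in> V" "v \<in> V"
  show "{u, v} \<in> E \<longleftrightarrow> {f u, f v} \<in> F"
  proof
    assume "{u, v} \<in> E"
    then have "f ` {u, v} \<in> F" using F by blast
    then show "{f u, f v} \<in> F" by simp
  next
    assume "{f u, f v} \<in> F"
    then obtain e where e: "e \<in> E" "f ` {u, v} = f ` e" using F by auto
    have "{u, v} = e"
      using inj_on_image_eq_iff[OF inj, of "{u, v}" e] e E uv by auto
    then show "{u, v} \<in> E" using e by simp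
  qed
qed (rule f)

text \<open>The isomorphism is inverted so that a graph isomorphic to a fixed labelled graph gets
  its vertices named by the labels and its edge set as an explicit image.\<close>

lemma graph_iso_inverseE:
  assumes iso: "graph_iso V E W F" and "simple_graph V E" "simple_graph W F"
  obtains g where "bij_betw g W V" "E = (`) g ` F"
proof -
  obtain f where f: "bij_betw f V W"
      and fE: "\<And>u v. u \<in> V \<Longrightarrow> v \<in> V \<Longrightarrow> {u, v} \<in> E \<longleftrightarrow> {f u, f v} \<in> F"
    using iso unfolding graph_iso_def by blast
  define g where "g = inv_into V f"
  have g: "bij_betw g W V" unfolding g_def by (rule bij_betw_inv_into[OF f])
  have gf: "g (f u) = u" if "u \<in> V" for u
    unfolding g_def by (rule bij_betw_inv_into_left[OF f that])
  have fg: "f (g x) = x" if "x \<in> W" for x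
    unfolding g_def by (rule bij_betw_inv_into_right[OF f that])
  have gV: "g x \<in> V" if "x \<in> W" for x using g that by (rule bij_betwE[rule_format])
  have "E = (`) g ` F"
  proof (intro equalityI subsetI)
    fix e assume e: "e \<in> E"
    then obtain u v where uv: "e = {u, v}" "u \<in> V" "v \<in> V"
      using simple_graph_edge[OF assms(2)] by blast
    have "e = g ` {f u, f v}" using uv gf by simp
    moreover have "{f u, f v} \<in> F" using fE[OF uv(2,3)] e uv(1) by simp
    ultimately show "e \<in> (`) g ` F" by (rule image_eqI)
  next
    fix e assume "e \<in> (`) g ` F"
    then obtain x where x: "x \<in> F" "e = g ` x" by blast
    then obtain i j where ij: "x = {i, j}" "i \<in> W" "j \<in> W"
      using simple_graph_edge[OF assms(3)] by blast
    have "{g i, g j} \<in> E"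
      unfolding fE[OF gV[OF ij(2)] gV[OF ij(3)]] fg[OF ij(2)] fg[OF ij(3)] using ij(1) x(1) by simp
    then show "e \<in> E" using ij(1) x(2) by simp
  qed
  then show thesis by (rule that[OF g])
qed

section \<open>The three exceptional graphs\<close>

lemma simple_graph_exceptional:
  "simple_graph {1..4} G1_edges" "simple_graph {1..4} G2_edges" "simple_graph {1..4} G3_edges"
  by (simp_all add: simple_graph_def G1_edges_def G2_edges_def G3_edges_def)

lemma atLeastAtMost_1_4: "{1..4} = {1, 2, 3, 4::nat}"
  by auto

lemma bij_betw_four:
  assumes "distinct [a, b, c, d]"
  obtains f where "bij_betw f {a, b, c, d} {1..4::nat}" "f a = 1" "f b = 2" "f c = 3" "f d = 4"
proof
  let ?f = "\<lambda>x. if x = a then 1 else if x = b then 2 else if x = c then 3 else 4::nat"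
  show "bij_betw ?f {a, b, c, d} {1..4}"
    using assms unfolding bij_betw_def atLeastAtMost_1_4 by (auto simp: inj_on_def)
qed (use assms in auto)

lemma graph_iso_G1:
  assumes "distinct [a, b, c, d]"
  shows "graph_iso {a, b, c, d} {{a, b}, {b, c}, {b, d}, {c, d}}
    {1..4::nat} G1_edges"
proof -
  obtain f where "bij_betw f {a, b, c, d} {1..4::nat}" "f a = 1" "f b = 2" "f c = 3" "f d = 4"
    by (rule bij_betw_four[OF assms])
  then show ?thesis by (intro graph_isoI[of f]) (simp_all add: G1_edges_def)
qed

lemma graph_iso_G2:
  assumes "distinct [a, b, c, d]"
  shows "graph_iso {a, b, c, d} {{a, b}, {b, c}, {c, d}, {a, c}, {b, d}}
    {1..4::nat} G2_edges"
proof -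
  obtain f where "bij_betw f {a, b, c, d} {1..4::nat}" "f a = 1" "f b = 2" "f c = 3" "f d = 4"
    by (rule bij_betw_four[OF assms])
  then show ?thesis by (intro graph_isoI[of f]) (simp_all add: G2_edges_def)
qed

lemma graph_iso_G3:
  assumes "distinct [a, b, c, d]"
  shows "graph_iso {a, b, c, d} {{a, b}, {a, c}, {a, d}, {b, c}, {b, d}, {c, d}}
    {1..4::nat} G3_edges"
proof -
  obtain f where "bij_betw f {a, b, c, d} {1..4::nat}" "f a = 1" "f b = 2" "f c = 3" "f d = 4"
    by (rule bij_betw_four[OF assms])
  then show ?thesis by (intro graph_isoI[of f]) (simp_all add: G3_edges_def)
qed

lemma bij_betw_four_distinct:
  assumes "bij_betw g {1..4::nat} V"
  shows "V = {g 1, g 2, g 3, g 4}" "distinct [g 1, g 2, g 3, g 4]"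
  using assms unfolding bij_betw_def atLeastAtMost_1_4 by (auto simp: inj_on_def)

lemma graph_iso_G1E:
  assumes "graph_iso V E {1..4::nat} G1_edges" "simple_graph V E"
  obtains a b c d where "distinct [a, b, c, d]" "V = {a, b, c, d}"
    "E = {{a, b}, {b, c}, {b, d}, {c, d}}"
proof -
  obtain g where g: "bij_betw g {1..4::nat} V" "E = (`) g ` G1_edges"
    using graph_iso_inverseE[OF assms simple_graph_exceptional(1)] .
  show thesis
    by (rule that[OF bij_betw_four_distinct(2,1)[OF g(1)]])
      (simp only: g(2) G1_edges_def image_insert image_empty)
qed

lemma graph_iso_G2E:
  assumes "graph_iso V E {1..4::nat} G2_edges" "simple_graph V E"
  obtains a b c d where "distinct [a, b, c, d]" "V = {a, b, c, d}"
    "E = {{a, b}, {b, c}, {c, d}, {a, c}, {b, d}}"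
proof -
  obtain g where g: "bij_betw g {1..4::nat} V" "E = (`) g ` G2_edges"
    using graph_iso_inverseE[OF assms simple_graph_exceptional(2)] .
  show thesis
    by (rule that[OF bij_betw_four_distinct(2,1)[OF g(1)]])
      (simp only: g(2) G2_edges_def image_insert image_empty)
qed

lemma graph_iso_G3E:
  assumes "graph_iso V E {1..4::nat} G3_edges" "simple_graph V E"
  obtains a b c d where "distinct [a, b, c, d]" "V = {a, b, c, d}"
    "E = {{a, b}, {a, c}, {a, d}, {b, c}, {b, d}, {c, d}}"
proof -
  obtain g where g: "bij_betw g {1..4::nat} V" "E = (`) g ` G3_edges"
    using graph_iso_inverseE[OF assms simple_graph_exceptional(3)] .
  show thesis
    by (rule that[OF bij_betw_four_distinct(2,1)[OF g(1)]])
      (simp only: g(2) G3_edges_def image_insert image_empty)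
qed

section \<open>Automorphisms of the line graph\<close>

lemma line_graph_edges_iff:
  "{e, e'} \<in> line_graph_edges E \<longleftrightarrow> e \<in> E \<and> e' \<in> E \<and> e \<noteq> e' \<and> e \<inter> e' \<noteq> {}"
  unfolding line_graph_edges_def by (auto simp: doubleton_eq_iff)

lemma aut_line_graph_iff:
  assumes "{} \<notin> E"
  shows "\<phi> \<in> aut E (line_graph_edges E) \<longleftrightarrow>
    bij_betw \<phi> E E \<and> (\<forall>e\<in>E. \<forall>e'\<in>E. e \<inter> e' \<noteq> {} \<longleftrightarrow> \<phi> e \<inter> \<phi> e' \<noteq> {})"
proof -
  have "(\<forall>e\<in>E. \<forall>e'\<in>E. {e, e'} \<in> line_graph_edges E \<longleftrightarrow> {\<phi> e, \<phi> e'} \<in> line_graph_edges E)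
      \<longleftrightarrow> (\<forall>e\<in>E. \<forall>e'\<in>E. e \<inter> e' \<noteq> {} \<longleftrightarrow> \<phi> e \<inter> \<phi> e' \<noteq> {})" if bij: "bij_betw \<phi> E E"
  proof (intro ball_cong refl)
    fix e e' assume e: "e \<in> E" "e' \<in> E"
    have im: "\<phi> e \<in> E" "\<phi> e' \<in> E" using bij e by (auto dest: bij_betwE)
    have "\<phi> e = \<phi> e' \<longleftrightarrow> e = e'"
      using bij_betw_imp_inj_on[OF bij] e by (rule inj_on_eq_iff)
    moreover have "e \<noteq> {}" "\<phi> e \<noteq> {}" using e im assms by metis+
    ultimately show "({e, e'} \<in> line_graph_edges E \<longleftrightarrow> {\<phi> e, \<phi> e'} \<in> line_graph_edges E)
      \<longleftrightarrow> (e \<inter> e' \<noteq> {} \<longleftrightarrow> \<phi> e \<inter> \<phi> e' \<noteq> {})"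
      unfolding line_graph_edges_iff using e im by (cases "e = e'") auto
  qed
  then show ?thesis unfolding aut_def mem_Collect_eq by (rule conj_cong[OF refl])
qed

text \<open>Twins \<open>e\<close>, \<open>e'\<close> can be exchanged by an automorphism that moves nothing else.\<close>

lemma vertex_determining_meets_twins:
  assumes "vertex_determining E (line_graph_edges E) S" and "{} \<notin> E"
    and e: "e \<in> E" "e' \<in> E" "e \<noteq> e'"
    and twins: "\<forall>x\<in>E. x = e \<or> x = e' \<or> x \<inter> e \<noteq> {} \<and> x \<inter> e' \<noteq> {}"
  shows "e \<in> S \<or> e' \<in> S"
proof (rule ccontr)
  assume no: "\<not> (e \<in> S \<or> e' \<in> S)"
  let ?\<phi> = "transpose e e'"
  have ne: "x \<noteq> {}" if "x \<in> E" for x using that assms(2) by metis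
  have tw: "x \<inter> e = {} \<longleftrightarrow> x \<inter> e' = {}" "e \<inter> x = {} \<longleftrightarrow> e' \<inter> x = {}"
    if "x \<in> E" "x \<noteq> e" "x \<noteq> e'" for x using twins that by auto
  have "bij_betw ?\<phi> E E" using e by (intro bij_betw_transpose_iff) simp
  moreover have "x \<inter> y = {} \<longleftrightarrow> ?\<phi> x \<inter> ?\<phi> y = {}" if "x \<in> E" "y \<in> E" for x y
    using that tw[of x] tw[of y] ne e
    by (cases "x = e"; cases "x = e'"; cases "y = e"; cases "y = e'")
      (auto simp: transpose_def)
  ultimately have "?\<phi> \<in> aut E (line_graph_edges E)"
    unfolding aut_line_graph_iff[OF assms(2)] by blast
  moreover have "\<forall>x\<in>S. ?\<phi> x = x" using no by (auto simp: transpose_def)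
  ultimately have "?\<phi> e = e" using assms(1) e unfolding vertex_determining_def by blast
  then show False using e by simp
qed

section \<open>Determining numbers for the exceptional graphs\<close>

lemma vertex_determining_UNIV: "vertex_determining V E V"
  unfolding vertex_determining_def by blast

text \<open>The full vertex set is determining, so the \<open>LEAST\<close> is attained and a bound
  valid for every determining set passes to it.\<close>

lemma determining_number_geI:
  assumes "\<And>S. vertex_determining V E S \<Longrightarrow> n \<le> card S"
  shows "n \<le> determining_number V E"
proof -
  have "\<exists>S. vertex_determining V E S \<and> card S = determining_number V E"
    unfolding determining_number_def by (rule LeastI_ex) (use vertex_determining_UNIV in blast)
  then show ?thesis using assms by metis
qed

lemma determining_index_leI:
  assumes "edge_determining V E T" "card T \<le> n"
  shows "determining_index V E \<le> n"
proof -
  have "determining_index V E \<le> card T"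
    unfolding determining_index_def by (rule Least_le) (use assms in blast)
  then show ?thesis using assms by simp
qed

text \<open>This is a triangle \<open>b\<close>, \<open>c\<close>, \<open>d\<close> with a pendant
  vertex \<open>a\<close> at \<open>b\<close>. Its line graph is \<open>K_4\<close> minus an edge,
  in which both the nonadjacent pair and the complementary pair are twins.\<close>

lemma determining_index_less_G1:
  assumes d: "distinct [a, b, c, d]"
  defines "V \<equiv> {a, b, c, d}" and "E \<equiv> {{a, b}, {b, c}, {b, d}, {c, d}}"
  shows "determining_index V E < determining_number E (line_graph_edges E)"
proof -
  have "edge_determining V E {{b, c}}"
    unfolding edge_determining_def
  proof (intro conjI ballI impI)
    fix f x assume f: "f \<in> aut V E" "\<forall>e\<in>{{b, c}}. f ` e = e" "x \<in> V"
    have bij: "bij_betw f V V" using f(1) unfolding aut_def by blast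
    have img: "f a \<in> V" "f b \<in> V" "f c \<in> V" "f d \<in> V"
      using bij_betwE[OF bij] by (simp_all add: V_def)
    have inj: "f a \<noteq> f b" "f a \<noteq> f c" "f a \<noteq> f d" "f b \<noteq> f c" "f b \<noteq> f d" "f c \<noteq> f d"
      using d inj_on_eq_iff[OF bij_betw_imp_inj_on[OF bij]] by (simp_all add: V_def)
    define adj where "adj u v \<longleftrightarrow> {u, v} \<in> E" for u v
    have sym: "adj u v \<longleftrightarrow> adj v u" for u v by (simp add: adj_def insert_commute)
    have table: "adj a b" "\<not> adj a c" "\<not> adj a d" "adj b c" "adj b d" "adj c d"
      using d by (auto simp: adj_def E_def doubleton_eq_iff)
    have "adj u v \<longleftrightarrow> adj (f u) (f v)" if "u \<in> V" "v \<in> V" for u v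
      using f(1) that unfolding aut_def adj_def by blast
    then have pres:
      "adj a b \<longleftrightarrow> adj (f a) (f b)" "adj a c \<longleftrightarrow> adj (f a) (f c)" "adj a d \<longleftrightarrow> adj (f a) (f d)"
      "adj b c \<longleftrightarrow> adj (f b) (f c)" "adj b d \<longleftrightarrow> adj (f b) (f d)" "adj c d \<longleftrightarrow> adj (f c) (f d)"
      by (simp_all add: V_def)
    have fix_edge: "{f b, f c} = {b, c}" using f(2) by simp
    \<comment> \<open>The edge cannot be reversed, since \<open>b\<close> has degree 3 and
      \<open>c\<close> degree 2. Then \<open>d\<close> is adjacent to \<open>c\<close> while
      \<open>a\<close> is not.\<close>
    have "f a = a \<and> f b = b \<and> f c = c \<and> f d = d"
      using fix_edge[unfolded doubleton_eq_iff] img[unfolded V_def insert_iff empty_iff]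
        inj pres table sym by (smt (verit))
    then show "f x = x" using f(3) unfolding V_def by blast
  qed (simp add: E_def)
  then have "determining_index V E \<le> 1" by (rule determining_index_leI) simp
  moreover have "2 \<le> determining_number E (line_graph_edges E)"
  proof (rule determining_number_geI)
    fix S assume S: "vertex_determining E (line_graph_edges E) S"
    have E: "{} \<notin> E" unfolding E_def by simp
    have "S \<subseteq> E" using S unfolding vertex_determining_def by (rule conjunct1)
    then have "finite S" by (rule finite_subset) (simp add: E_def)
    have "{a, b} \<in> S \<or> {c, d} \<in> S"
      by (rule vertex_determining_meets_twins[OF S E])
        (use d in \<open>simp_all add: E_def doubleton_eq_iff\<close>)
    moreover have "{b, c} \<in> S \<or> {b, d} \<in> S"
      by (rule vertex_determining_meets_twins[OF S E])
        (use d in \<open>simp_all add: E_def doubleton_eq_iff\<close>)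
    ultimately obtain x y where xy: "{x, y} \<subseteq> S" "x \<in> {{a, b}, {c, d}}" "y \<in> {{b, c}, {b, d}}"
      by blast
    have "x \<noteq> y" using xy(2,3) d by (auto simp: doubleton_eq_iff)
    with xy(1) show "2 \<le> card S" using card_mono[OF \<open>finite S\<close>, of "{x, y}"] by simp
  qed
  ultimately show ?thesis by simp
qed

text \<open>This is \<open>K_4\<close> minus the edge \<open>{a, d}\<close>. Its line graph is a
  wheel with hub \<open>{b, c}\<close> and a rim of length four, whose two pairs of opposite rim
  vertices are twins.\<close>

lemma determining_index_less_G2:
  assumes d: "distinct [a, b, c, d]"
  defines "V \<equiv> {a, b, c, d}" and "E \<equiv> {{a, b}, {b, c}, {c, d}, {a, c}, {b, d}}"
  shows "determining_index V E < determining_number E (line_graph_edges E)"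
proof -
  have "edge_determining V E {{a, b}}"
    unfolding edge_determining_def
  proof (intro conjI ballI impI)
    fix f x assume f: "f \<in> aut V E" "\<forall>e\<in>{{a, b}}. f ` e = e" "x \<in> V"
    have bij: "bij_betw f V V" using f(1) unfolding aut_def by blast
    have img: "f a \<in> V" "f b \<in> V" "f c \<in> V" "f d \<in> V"
      using bij_betwE[OF bij] by (simp_all add: V_def)
    have inj: "f a \<noteq> f b" "f a \<noteq> f c" "f a \<noteq> f d" "f b \<noteq> f c" "f b \<noteq> f d" "f c \<noteq> f d"
      using d inj_on_eq_iff[OF bij_betw_imp_inj_on[OF bij]] by (simp_all add: V_def)
    define adj where "adj u v \<longleftrightarrow> {u, v} \<in> E" for u v
    have sym: "adj u v \<longleftrightarrow> adj v u" for u v by (simp add: adj_def insert_commute)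
    have table: "adj a b" "adj a c" "\<not> adj a d" "adj b c" "adj b d" "adj c d"
      using d by (auto simp: adj_def E_def doubleton_eq_iff)
    have "adj u v \<longleftrightarrow> adj (f u) (f v)" if "u \<in> V" "v \<in> V" for u v
      using f(1) that unfolding aut_def adj_def by blast
    then have pres:
      "adj a b \<longleftrightarrow> adj (f a) (f b)" "adj a c \<longleftrightarrow> adj (f a) (f c)" "adj a d \<longleftrightarrow> adj (f a) (f d)"
      "adj b c \<longleftrightarrow> adj (f b) (f c)" "adj b d \<longleftrightarrow> adj (f b) (f d)" "adj c d \<longleftrightarrow> adj (f c) (f d)"
      by (simp_all add: V_def)
    have fix_edge: "{f a, f b} = {a, b}" using f(2) by simp
    \<comment> \<open>Here \<open>a\<close> has degree 2 and \<open>b\<close> degree 3, so both are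
      fixed. Then \<open>c\<close> is adjacent to \<open>a\<close> while \<open>d\<close> is
      not.\<close>
    have "f a = a \<and> f b = b \<and> f c = c \<and> f d = d"
      using fix_edge[unfolded doubleton_eq_iff] img[unfolded V_def insert_iff empty_iff]
        inj pres table sym by (smt (verit))
    then show "f x = x" using f(3) unfolding V_def by blast
  qed (simp add: E_def)
  then have "determining_index V E \<le> 1" by (rule determining_index_leI) simp
  moreover have "2 \<le> determining_number E (line_graph_edges E)"
  proof (rule determining_number_geI)
    fix S assume S: "vertex_determining E (line_graph_edges E) S"
    have E: "{} \<notin> E" unfolding E_def by simp
    have "S \<subseteq> E" using S unfolding vertex_determining_def by (rule conjunct1)
    then have "finite S" by (rule finite_subset) (simp add: E_def)
    have "{a, b} \<in> S \<or> {c, d} \<in> S"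
      by (rule vertex_determining_meets_twins[OF S E])
        (use d in \<open>simp_all add: E_def doubleton_eq_iff\<close>)
    moreover have "{a, c} \<in> S \<or> {b, d} \<in> S"
      by (rule vertex_determining_meets_twins[OF S E])
        (use d in \<open>simp_all add: E_def doubleton_eq_iff\<close>)
    ultimately obtain x y where xy: "{x, y} \<subseteq> S" "x \<in> {{a, b}, {c, d}}" "y \<in> {{a, c}, {b, d}}"
      by blast
    have "x \<noteq> y" using xy(2,3) d by (auto simp: doubleton_eq_iff)
    with xy(1) show "2 \<le> card S" using card_mono[OF \<open>finite S\<close>, of "{x, y}"] by simp
  qed
  ultimately show ?thesis by simp
qed

text \<open>The line graph of \<open>K_4\<close> is the octahedron; its three antipodal pairs, which
  are the perfect matchings of \<open>K_4\<close>, are twins.\<close>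

lemma determining_index_less_G3:
  assumes d: "distinct [a, b, c, d]"
  defines "V \<equiv> {a, b, c, d}" and "E \<equiv> {{a, b}, {a, c}, {a, d}, {b, c}, {b, d}, {c, d}}"
  shows "determining_index V E < determining_number E (line_graph_edges E)"
proof -
  have "edge_determining V E {{a, b}, {b, c}}"
    unfolding edge_determining_def
  proof (intro conjI ballI impI)
    fix f x assume f: "f \<in> aut V E" "\<forall>e\<in>{{a, b}, {b, c}}. f ` e = e" "x \<in> V"
    have bij: "bij_betw f V V" using f(1) unfolding aut_def by blast
    have img: "f a \<in> V" "f b \<in> V" "f c \<in> V" "f d \<in> V"
      using bij_betwE[OF bij] by (simp_all add: V_def)
    have inj: "f a \<noteq> f b" "f a \<noteq> f c" "f a \<noteq> f d" "f b \<noteq> f c" "f b \<noteq> f d" "f c \<noteq> f d"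
      using d inj_on_eq_iff[OF bij_betw_imp_inj_on[OF bij]] by (simp_all add: V_def)
    have fix_edges: "{f a, f b} = {a, b}" "{f b, f c} = {b, c}" using f(2) by simp_all
    \<comment> \<open>The two fixed edges share only \<open>b\<close>, so \<open>b\<close> is fixed,
      then their other ends, and \<open>d\<close> is what remains.\<close>
    have "f a = a \<and> f b = b \<and> f c = c \<and> f d = d"
      using fix_edges img inj d unfolding V_def by (simp add: doubleton_eq_iff) metis
    then show "f x = x" using f(3) unfolding V_def by blast
  qed (simp add: E_def)
  then have "determining_index V E \<le> 2"
    by (rule determining_index_leI) (simp add: card_insert_if)
  moreover have "3 \<le> determining_number E (line_graph_edges E)"
  proof (rule determining_number_geI)
    fix S assume S: "vertex_determining E (line_graph_edges E) S"
    have E: "{} \<notin> E" unfolding E_def by simp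
    have "S \<subseteq> E" using S unfolding vertex_determining_def by (rule conjunct1)
    then have "finite S" by (rule finite_subset) (simp add: E_def)
    have "{a, b} \<in> S \<or> {c, d} \<in> S"
      by (rule vertex_determining_meets_twins[OF S E])
        (use d in \<open>simp_all add: E_def doubleton_eq_iff\<close>)
    moreover have "{a, c} \<in> S \<or> {b, d} \<in> S"
      by (rule vertex_determining_meets_twins[OF S E])
        (use d in \<open>simp_all add: E_def doubleton_eq_iff\<close>)
    moreover have "{a, d} \<in> S \<or> {b, c} \<in> S"
      by (rule vertex_determining_meets_twins[OF S E])
        (use d in \<open>simp_all add: E_def doubleton_eq_iff\<close>)
    ultimately obtain x y z where xyz: "{x, y, z} \<subseteq> S"
      "x \<in> {{a, b}, {c, d}}" "y \<in> {{a, c}, {b, d}}" "z \<in> {{a, d}, {b, c}}"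
      by blast
    have "x \<noteq> y" using xyz(2,3) d by (elim insertE) (auto simp: doubleton_eq_iff)
    moreover have "x \<noteq> z" using xyz(2,4) d by (elim insertE) (auto simp: doubleton_eq_iff)
    moreover have "y \<noteq> z" using xyz(3,4) d by (elim insertE) (auto simp: doubleton_eq_iff)
    ultimately show "3 \<le> card S" using card_mono[OF \<open>finite S\<close> xyz(1)] by simp
  qed
  ultimately show ?thesis by simp
qed

section \<open>Claws and triangles\<close>

lemma doubletons_meet_iff: "{p, q} \<inter> {r, s} \<noteq> {} \<longleftrightarrow> p = r \<or> p = s \<or> q = r \<or> q = s"
  by auto

text \<open>Nested equivalences of three propositions express that an odd number of them hold, so
  the negation is the even case. Only the relation of meeting enters, which makes the notion visible
  in the line graph.\<close>

definition even_triple :: "'a set set \<Rightarrow> 'a set \<Rightarrow> 'a set \<Rightarrow> 'a set \<Rightarrow> bool" where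
  "even_triple E e1 e2 e3 \<longleftrightarrow> (\<forall>x\<in>E - {e1, e2, e3}.
     \<not> (x \<inter> e1 \<noteq> {} \<longleftrightarrow> (x \<inter> e2 \<noteq> {} \<longleftrightarrow> x \<inter> e3 \<noteq> {})))"

text \<open>An edge that is not a side contains at most one corner, and each corner lies on exactly
  two sides. The number of sides met is therefore 0 or 2.\<close>

lemma even_triple_triangle:
  assumes "simple_graph V E" "distinct [x, y, z]"
  shows "even_triple E {x, y} {y, z} {x, z}"
  unfolding even_triple_def
proof
  fix e assume e: "e \<in> E - {{x, y}, {y, z}, {x, z}}"
  then obtain u v where uv: "e = {u, v}" "u \<noteq> v" using simple_graph_edge[OF assms(1)] by blast
  show "\<not> (e \<inter> {x, y} \<noteq> {} \<longleftrightarrow> (e \<inter> {y, z} \<noteq> {} \<longleftrightarrow> e \<inter> {x, z} \<noteq> {}))"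
    using e assms(2) uv unfolding uv(1) doubletons_meet_iff
    by (simp add: doubleton_eq_iff) (smt (verit))
qed

text \<open>With no point common to all three, the pairwise common points are distinct, and two of
  them exhaust each edge.\<close>

lemma pairwise_meeting_edges_triangle:
  assumes "card e1 = 2" "card e2 = 2" "card e3 = 2"
    and "e1 \<inter> e2 \<noteq> {}" "e1 \<inter> e3 \<noteq> {}" "e2 \<inter> e3 \<noteq> {}" "e1 \<inter> e2 \<inter> e3 = {}"
  obtains x y z where "distinct [x, y, z]" "e1 = {x, y}" "e2 = {y, z}" "e3 = {x, z}"
proof -
  obtain x y z where m: "y \<in> e1" "y \<in> e2" "x \<in> e1" "x \<in> e3" "z \<in> e2" "z \<in> e3"
    using assms by blast
  then have d: "x \<noteq> y" "x \<noteq> z" "y \<noteq> z" using assms(7) by blast+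
  have "e = {p, q}" if "card e = 2" "p \<in> e" "q \<in> e" "p \<noteq> q" for e and p q :: 'a
    using that by (auto simp: card_2_iff)
  from this[OF assms(1) m(3,1)] this[OF assms(2) m(2,5)] this[OF assms(3) m(4,6)]
  show thesis using that[of x y z] d by simp
qed

section \<open>Stars and claws in a connected graph\<close>

locale connected_graph3 =
  fixes V :: "'a set" and E :: "'a set set"
  assumes simple: "simple_graph V E"
    and conn: "connected_graph V E"
    and card3: "card V \<ge> 3"
begin

lemma empty_notin: "{} \<notin> E"
  using simple unfolding simple_graph_def by fastforce

text \<open>Connectedness enters the later arguments only in this form, as a closure principle
  replacing paths.\<close>

lemma closed_subset_eq:
  assumes "v \<in> U" "U \<subseteq> V" and closed: "\<And>p q. {p, q} \<in> E \<Longrightarrow> p \<in> U \<Longrightarrow> q \<in> U"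
  shows "U = V"
proof
  show "V \<subseteq> U"
  proof
    fix w assume "w \<in> V"
    then have "(v, w) \<in> {(x, y). {x, y} \<in> E}\<^sup>*"
      using conn assms(1,2) unfolding connected_graph_def by blast
    then show "w \<in> U" by induction (use assms(1) closed in auto)
  qed
qed (rule assms(2))

text \<open>The trace of a vertex in the line graph: a clique from which the vertex is to be
  recovered.\<close>

definition star :: "'a \<Rightarrow> 'a set set" where
  "star v = {e \<in> E. v \<in> e}"

lemma star_nonempty:
  assumes "v \<in> V" shows "star v \<noteq> {}"
proof
  assume "star v = {}"
  then have "{v} = V" using assms by (intro closed_subset_eq[of v]) (auto simp: star_def)
  then show False using card3 by auto
qed

text \<open>If two vertices had the same star, each edge at one of them would join the two, so they
  would form a closed set and exhaust \<open>V\<close>, against \<open>card3\<close>.\<close>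

lemma inj_on_star: "inj_on star V"
proof (rule inj_onI, rule ccontr)
  fix u v assume uv: "u \<in> V" "v \<in> V" "star u = star v" "u \<noteq> v"
  have "{u, v} = V"
  proof (rule closed_subset_eq[of u])
    fix p q assume pq: "{p, q} \<in> E" "p \<in> {u, v}"
    have "{p, q} \<in> star u \<longleftrightarrow> {p, q} \<in> star v" using uv(3) by simp
    then have "u \<in> {p, q}" "v \<in> {p, q}" using pq by (auto simp: star_def)
    then show "q \<in> {u, v}" using pq(2) uv(4) by auto
  qed (use uv in auto)
  then show False using card3 uv(4) by auto
qed

lemma common_vertex_unique:
  assumes "e \<in> E" "e' \<in> E" "e \<noteq> e'" "v \<in> e" "v \<in> e'" "w \<in> e" "w \<in> e'"
  shows "v = w"
proof -
  obtain a b where "e = {v, a}" "e' = {v, b}"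
    using simple_graph_other_end[OF simple assms(1,4)]
      simple_graph_other_end[OF simple assms(2,5)] by metis
  then show ?thesis using assms(3,6,7) by blast
qed

text \<open>An edge leaving the claw's vertex set would meet one claw edge when it starts at a leaf
  and all three when it starts at \<open>v\<close>, an odd number either way. So the graph has four
  vertices, and 0, 1, 2 or 3 edges between leaves give the claw, \<open>G1\<close>,
  \<open>G2\<close> or \<open>G3\<close>.\<close>

lemma even_claw_cases:
  assumes claw: "distinct [v, a, b, c]" "{v, a} \<in> E" "{v, b} \<in> E" "{v, c} \<in> E"
    and even: "even_triple E {v, a} {v, b} {v, c}"
  shows "E = {{v, a}, {v, b}, {v, c}} \<or> graph_iso V E {1..4::nat} G1_edges \<or>
    graph_iso V E {1..4::nat} G2_edges \<or> graph_iso V E {1..4::nat} G3_edges"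
proof -
  have closed: "q \<in> {v, a, b, c}" if pq: "{p, q} \<in> E" "p \<in> {v, a, b, c}" for p q
  proof (rule ccontr)
    assume q: "q \<notin> {v, a, b, c}"
    then have "{p, q} \<notin> {{v, a}, {v, b}, {v, c}}" by (auto simp: doubleton_eq_iff)
    with pq(1) have "{p, q} \<in> E - {{v, a}, {v, b}, {v, c}}" by (rule DiffI)
    then have "\<not> ({p, q} \<inter> {v, a} \<noteq> {} \<longleftrightarrow> ({p, q} \<inter> {v, b} \<noteq> {} \<longleftrightarrow> {p, q} \<inter> {v, c} \<noteq> {}))"
      by (rule bspec[OF even[unfolded even_triple_def]])
    then show False
      unfolding doubletons_meet_iff using pq(2) q claw(1) by (elim insertE) auto
  qed
  have "{v, a} \<subseteq> V" "{v, b} \<subseteq> V" "{v, c} \<subseteq> V"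
    using claw(2-4) simple unfolding simple_graph_def by blast+
  then have sub: "{v, a, b, c} \<subseteq> V" by simp
  have V: "{v, a, b, c} = V"
    by (rule closed_subset_eq[OF _ sub, of v]) (simp, rule closed)
  have E: "e \<in> {{v, a}, {v, b}, {v, c}, {a, b}, {a, c}, {b, c}}" if e: "e \<in> E" for e
  proof -
    obtain p q where pq: "e = {p, q}" "p \<noteq> q" "p \<in> V" "q \<in> V"
      using simple_graph_edge[OF simple e] by blast
    show ?thesis
      using pq(2) pq(3,4)[folded V] unfolding pq(1)
      by (elim insertE) (simp_all add: insert_commute)
  qed
  \<comment> \<open>\<open>P e\<close> is an optional edge, which lets one formula for
    \<open>E\<close> serve all eight cases.\<close>
  define P where "P e = (if e \<in> E then {e} else {})" for e
  have E_eq: "E = {{v, a}, {v, b}, {v, c}} \<union> P {a, b} \<union> P {a, c} \<union> P {b, c}"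
  proof (intro equalityI subsetI)
    fix e assume e: "e \<in> E"
    show "e \<in> {{v, a}, {v, b}, {v, c}} \<union> P {a, b} \<union> P {a, c} \<union> P {b, c}"
      using E[OF e] e by (elim insertE) (simp_all add: P_def)
  next
    fix e assume "e \<in> {{v, a}, {v, b}, {v, c}} \<union> P {a, b} \<union> P {a, c} \<union> P {b, c}"
    then show "e \<in> E" using claw(2-4) by (auto simp: P_def split: if_splits)
  qed
  \<comment> \<open>Vertex orders matching the labels 1 to 4. For \<open>G1_edges\<close> the
    pendant vertex comes first and \<open>v\<close> second; for \<open>G2_edges\<close> the first
    and last entries are the nonadjacent pair.\<close>
  have perm: "{a, v, b, c} = V" "{b, v, a, c} = V" "{c, v, a, b} = V" "{a, v, c, b} = V"
    using V by (simp_all add: insert_commute)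
  have dist: "distinct [a, v, b, c]" "distinct [b, v, a, c]" "distinct [c, v, a, b]"
    "distinct [a, v, c, b]" using claw(1) by auto
  note iso_G1 = graph_iso_G1[OF dist(1)] graph_iso_G1[OF dist(2)] graph_iso_G1[OF dist(3)]
  note iso_G2 = graph_iso_G2[OF dist(1)] graph_iso_G2[OF dist(2)] graph_iso_G2[OF dist(4)]
  consider
      (none) "{a, b} \<notin> E" "{a, c} \<notin> E" "{b, c} \<notin> E"
    | (ab) "{a, b} \<in> E" "{a, c} \<notin> E" "{b, c} \<notin> E"
    | (ac) "{a, b} \<notin> E" "{a, c} \<in> E" "{b, c} \<notin> E"
    | (bc) "{a, b} \<notin> E" "{a, c} \<notin> E" "{b, c} \<in> E"
    | (ab_ac) "{a, b} \<in> E" "{a, c} \<in> E" "{b, c} \<notin> E"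
    | (ab_bc) "{a, b} \<in> E" "{a, c} \<notin> E" "{b, c} \<in> E"
    | (ac_bc) "{a, b} \<notin> E" "{a, c} \<in> E" "{b, c} \<in> E"
    | (all) "{a, b} \<in> E" "{a, c} \<in> E" "{b, c} \<in> E"
    by metis
  then show ?thesis
  proof cases
    case none
    have "E = {{v, a}, {v, b}, {v, c}}" by (subst E_eq) (use none in \<open>simp add: P_def\<close>)
    then show ?thesis by (rule disjI1)
  next
    case ab
    have E': "E = {{c, v}, {v, a}, {v, b}, {a, b}}"
      by (subst E_eq) (use ab in \<open>simp add: P_def insert_commute\<close>)
    show ?thesis using iso_G1(3) unfolding perm E'[symmetric] by blast
  next
    case ac
    have E': "E = {{b, v}, {v, a}, {v, c}, {a, c}}"
      by (subst E_eq) (use ac in \<open>simp add: P_def insert_commute\<close>)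
    show ?thesis using iso_G1(2) unfolding perm E'[symmetric] by blast
  next
    case bc
    have E': "E = {{a, v}, {v, b}, {v, c}, {b, c}}"
      by (subst E_eq) (use bc in \<open>simp add: P_def insert_commute\<close>)
    show ?thesis using iso_G1(1) unfolding perm E'[symmetric] by blast
  next
    case ab_ac
    have E': "E = {{b, v}, {v, a}, {a, c}, {b, a}, {v, c}}"
      by (subst E_eq) (use ab_ac in \<open>simp add: P_def insert_commute\<close>)
    show ?thesis using iso_G2(2) unfolding perm E'[symmetric] by blast
  next
    case ab_bc
    have E': "E = {{a, v}, {v, b}, {b, c}, {a, b}, {v, c}}"
      by (subst E_eq) (use ab_bc in \<open>simp add: P_def insert_commute\<close>)
    show ?thesis using iso_G2(1) unfolding perm E'[symmetric] by blast
  next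
    case ac_bc
    have E': "E = {{a, v}, {v, c}, {c, b}, {a, c}, {v, b}}"
      by (subst E_eq) (use ac_bc in \<open>simp add: P_def insert_commute\<close>)
    show ?thesis using iso_G2(3) unfolding perm E'[symmetric] by blast
  next
    case all
    have E': "E = {{v, a}, {v, b}, {v, c}, {a, b}, {a, c}, {b, c}}"
      by (subst E_eq) (use all in \<open>simp add: P_def insert_commute\<close>)
    show ?thesis using graph_iso_G3[OF claw(1)] unfolding V E'[symmetric] by blast
  qed
qed

text \<open>Three pairwise meeting edges without a common vertex form a triangle, so failure would
  make the image even and hence the claw even. Outside the exceptions the graph is then the claw
  itself, which contains no triangle.\<close>

lemma line_graph_aut_claw:
  assumes \<phi>: "\<phi> \<in> aut E (line_graph_edges E)"
    and exc: "\<not> graph_iso V E {1..4::nat} G1_edges" "\<not> graph_iso V E {1..4::nat} G2_edges"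
      "\<not> graph_iso V E {1..4::nat} G3_edges"
    and e: "e1 \<in> star v" "e2 \<in> star v" "e3 \<in> star v" "distinct [e1, e2, e3]"
  shows "\<phi> e1 \<inter> \<phi> e2 \<inter> \<phi> e3 \<noteq> {}"
proof
  assume none: "\<phi> e1 \<inter> \<phi> e2 \<inter> \<phi> e3 = {}"
  have bij: "bij_betw \<phi> E E"
    and meet: "\<And>e e'. e \<in> E \<Longrightarrow> e' \<in> E \<Longrightarrow> \<phi> e \<inter> \<phi> e' = {} \<longleftrightarrow> e \<inter> e' = {}"
    using \<phi> unfolding aut_line_graph_iff[OF empty_notin] by blast+
  have eE: "e1 \<in> E" "e2 \<in> E" "e3 \<in> E" "v \<in> e1" "v \<in> e2" "v \<in> e3"
    using e unfolding star_def by blast+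
  have \<phi>E: "\<phi> x \<in> E" if "x \<in> E" for x using bij that by (auto dest: bij_betwE)
  have card2: "card x = 2" if "x \<in> E" for x using simple that unfolding simple_graph_def by blast
  obtain x y z where "distinct [x, y, z]" "\<phi> e1 = {x, y}" "\<phi> e2 = {y, z}" "\<phi> e3 = {x, z}"
    by (rule pairwise_meeting_edges_triangle[of "\<phi> e1" "\<phi> e2" "\<phi> e3"])
      (use none eE in \<open>auto simp: card2 \<phi>E meet simp del: Int_iff\<close>)
  then have even: "even_triple E (\<phi> e1) (\<phi> e2) (\<phi> e3)"
    using even_triple_triangle[OF simple] by simp
  \<comment> \<open>Parity is pulled back along \<open>\<phi>\<close>, a bijection that preserves
    and reflects meeting.\<close>
  have even_e: "even_triple E e1 e2 e3"
    unfolding even_triple_def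
  proof
    fix x assume x: "x \<in> E - {e1, e2, e3}"
    then have "\<phi> x \<in> E - {\<phi> e1, \<phi> e2, \<phi> e3}"
      using \<phi>E eE bij_betw_imp_inj_on[OF bij] by (auto simp: inj_on_eq_iff)
    then show "\<not> (x \<inter> e1 \<noteq> {} \<longleftrightarrow> (x \<inter> e2 \<noteq> {} \<longleftrightarrow> x \<inter> e3 \<noteq> {}))"
      using even eE x unfolding even_triple_def by (metis meet DiffD1)
  qed
  have other: "\<exists>a. e = {v, a} \<and> a \<noteq> v" if "e \<in> E" "v \<in> e" for e
    using simple_graph_other_end[OF simple that] by blast
  obtain a b c where abc: "e1 = {v, a}" "a \<noteq> v" "e2 = {v, b}" "b \<noteq> v" "e3 = {v, c}" "c \<noteq> v"
    using other eE by metis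
  have "distinct [v, a, b, c]" using abc e(4) by auto
  then have E: "E = {e1, e2, e3}"
    using even_claw_cases[of v a b c, folded abc(1,3,5), OF _ eE(1-3) even_e] exc by simp
  \<comment> \<open>In the remaining graph \<open>K_{1,3}\<close> every edge passes through
    \<open>v\<close>, the three images included.\<close>
  have "v \<in> x" if "x \<in> E" for x using that eE(4-6) unfolding E by auto
  from this[OF \<phi>E[OF eE(1)]] this[OF \<phi>E[OF eE(2)]] this[OF \<phi>E[OF eE(3)]]
  show False using none by blast
qed

section \<open>Whitney's theorem\<close>

text \<open>Since claws go to claws, \<open>\<phi>\<close> permutes the stars. A vertex is
  determined by its star, so this permutation is a vertex map \<open>f\<close>, and preserved
  incidence makes \<open>f\<close> induce \<open>\<phi>\<close>.\<close>

lemma line_graph_aut_induced: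
  assumes \<phi>: "\<phi> \<in> aut E (line_graph_edges E)"
    and exc: "\<not> graph_iso V E {1..4::nat} G1_edges" "\<not> graph_iso V E {1..4::nat} G2_edges"
      "\<not> graph_iso V E {1..4::nat} G3_edges"
  obtains f where "f \<in> aut V E" "\<And>e. e \<in> E \<Longrightarrow> \<phi> e = f ` e"
proof -
  have edge_V: "w \<in> V" if "w \<in> e" "e \<in> E" for w e
    using that simple unfolding simple_graph_def by blast
  define \<psi> where "\<psi> = inv_into E \<phi>"
  have bij: "bij_betw \<phi> E E"
    and meet: "\<And>e e'. e \<in> E \<Longrightarrow> e' \<in> E \<Longrightarrow> \<phi> e \<inter> \<phi> e' = {} \<longleftrightarrow> e \<inter> e' = {}"
    using \<phi> unfolding aut_line_graph_iff[OF empty_notin] by blast+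
  have bij': "bij_betw \<psi> E E" unfolding \<psi>_def by (rule bij_betw_inv_into[OF bij])
  have inv: "\<phi> (\<psi> e) = e" "\<psi> (\<phi> e) = e" "\<psi> e \<in> E" "\<phi> e \<in> E" if "e \<in> E" for e
    using bij_betw_inv_into_right[OF bij that] bij_betw_inv_into_left[OF bij that]
      bij bij' that by (auto simp: \<psi>_def dest: bij_betwE)
  have \<psi>: "\<psi> \<in> aut E (line_graph_edges E)"
    unfolding aut_line_graph_iff[OF empty_notin] using bij' meet inv by metis
  \<comment> \<open>Two edges of the star fix the candidate \<open>w\<close> as the common end of
    their images; any third edge forms a claw with them, so its image also passes through
    \<open>w\<close>. The claim is kept general in \<open>\<theta>\<close> to serve both
    \<open>\<phi>\<close> and \<open>\<psi>\<close>.\<close>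
  have star_into: "\<exists>w\<in>V. \<theta> ` star v \<subseteq> star w"
    if \<theta>: "\<theta> \<in> aut E (line_graph_edges E)"
      and e: "e \<in> star v" "e' \<in> star v" "e \<noteq> e'" for \<theta> v e e'
  proof -
    have b: "bij_betw \<theta> E E" and m: "\<And>e e'. e \<in> E \<Longrightarrow> e' \<in> E \<Longrightarrow> \<theta> e \<inter> \<theta> e' = {} \<longleftrightarrow> e \<inter> e' = {}"
      using \<theta> unfolding aut_line_graph_iff[OF empty_notin] by blast+
    have eE: "e \<in> E" "e' \<in> E" "e \<inter> e' \<noteq> {}" using e unfolding star_def by blast+
    obtain w where w: "w \<in> \<theta> e" "w \<in> \<theta> e'" using m[OF eE(1,2)] eE(3) by blast
    have \<theta>E: "\<theta> x \<in> E" if "x \<in> E" for x using b that by (auto dest: bij_betwE)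
    have ne: "\<theta> e \<noteq> \<theta> e'" using bij_betw_imp_inj_on[OF b] eE e(3) by (auto simp: inj_on_eq_iff)
    have "w \<in> \<theta> x" if x: "x \<in> star v" for x
    proof (cases "x \<in> {e, e'}")
      case False
      then obtain u where u: "u \<in> \<theta> e" "u \<in> \<theta> e'" "u \<in> \<theta> x"
        using line_graph_aut_claw[OF \<theta> exc e(1,2) x] e(3) by auto
      then have "u = w" using common_vertex_unique[OF \<theta>E[OF eE(1)] \<theta>E[OF eE(2)] ne] w by blast
      then show ?thesis using u by simp
    qed (use w in auto)
    then show ?thesis using \<theta>E edge_V[OF w(1) \<theta>E[OF eE(1)]] unfolding star_def by blast
  qed
  \<comment> \<open>The inverse sends \<open>star w\<close> into some \<open>star u\<close>
    containing both \<open>e\<close> and \<open>e'\<close>. Distinct edges share at most one vertex,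
    so \<open>u = v\<close> and the inclusion is an equality.\<close>
  have star_eq: "\<exists>w\<in>V. \<theta> ` star v = star w"
    if \<theta>: "\<theta> \<in> aut E (line_graph_edges E)" and \<theta>': "\<theta>' \<in> aut E (line_graph_edges E)"
      and \<theta>\<theta>': "\<And>e. e \<in> E \<Longrightarrow> \<theta> (\<theta>' e) = e" "\<And>e. e \<in> E \<Longrightarrow> \<theta>' (\<theta> e) = e"
      and e: "e \<in> star v" "e' \<in> star v" "e \<noteq> e'" for \<theta> \<theta>' v e e'
  proof -
    obtain w where w: "w \<in> V" "\<theta> ` star v \<subseteq> star w" using star_into[OF \<theta> e] by blast
    have eE: "e \<in> E" "e' \<in> E" "v \<in> e" "v \<in> e'" using e unfolding star_def by blast+
    then have "\<theta> e \<noteq> \<theta> e'" using \<theta>\<theta>'(2) e(3) by metis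
    then obtain u where u: "\<theta>' ` star w \<subseteq> star u" using star_into[OF \<theta>', of "\<theta> e" w "\<theta> e'"] w e by blast
    then have "e \<in> star u" "e' \<in> star u" using w(2) e eE \<theta>\<theta>'(2) by (metis image_subset_iff)+
    then have "u = v"
      using common_vertex_unique[OF eE(1,2) e(3)] eE unfolding star_def by blast
    then have "x \<in> \<theta> ` star v" if "x \<in> star w" for x
      using that u \<theta>\<theta>'(1)[of x] by (force simp: star_def[of w])
    then show ?thesis using w by blast
  qed
  have star_image: "\<exists>w\<in>V. \<phi> ` star v = star w" if v: "v \<in> V" for v
  proof -
    obtain e where e: "e \<in> star v" using star_nonempty[OF v] by blast
    show ?thesis
    proof (cases "star v = {e}")
      case False
      then obtain e' where "e' \<in> star v" "e \<noteq> e'" using e by blast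
      then show ?thesis using star_eq[OF \<phi> \<psi> inv(1,2)] e by blast
    next
      \<comment> \<open>At a leaf \<open>v\<close> there are no two edges to apply
        \<open>star_eq\<close> to. Its image is reached through the neighbour \<open>u\<close>,
        whose star differs from that of \<open>v\<close> and hence has a second edge.\<close>
      case True
      have eE: "e \<in> E" "v \<in> e" using e unfolding star_def by blast+
      obtain u where u: "u \<in> V" "u \<noteq> v" "e = {v, u}"
        using simple_graph_other_end[OF simple eE] by blast
      then have eu: "e \<in> star u" using eE unfolding star_def by blast
      have "star u \<noteq> {e}" using inj_on_star u v True unfolding inj_on_def by metis
      then obtain e' where "e' \<in> star u" "e \<noteq> e'" using eu by blast
      then obtain w where w: "w \<in> V" "\<phi> ` star u = star w"
        using star_eq[OF \<phi> \<psi> inv(1,2) eu] by blast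
      have \<phi>e: "\<phi> e \<in> E" "w \<in> \<phi> e" using w(2) eu unfolding star_def by blast+
      obtain w' where w': "w' \<in> V" "w' \<noteq> w" "\<phi> e = {w, w'}"
        using simple_graph_other_end[OF simple \<phi>e] by blast
      then have ew': "\<phi> e \<in> star w'" using \<phi>e unfolding star_def by blast
      \<comment> \<open>Otherwise \<open>\<psi>\<close> maps \<open>star w'\<close> onto a star
        containing \<open>e\<close>, so onto that of \<open>v\<close> or \<open>u\<close>. The first
        is a singleton, and the second would give \<open>w' = w\<close>.\<close>
      have "star w' = {\<phi> e}"
      proof (rule ccontr)
        assume "star w' \<noteq> {\<phi> e}"
        then obtain d where d: "d \<in> star w'" "\<phi> e \<noteq> d" using ew' by blast
        then obtain x where x: "x \<in> V" "\<psi> ` star w' = star x"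
          using star_eq[OF \<psi> \<phi> inv(2,1) ew'] by blast
        have dE: "d \<in> E" using d unfolding star_def by blast
        have "e \<in> star x" using x(2) ew' inv(2)[OF eE(1)] by (metis image_eqI)
        then have "x \<in> {v, u}" using u unfolding star_def by blast
        moreover have "x \<noteq> v"
        proof
          assume "x = v"
          then have "\<psi> d = e" using x(2) d(1) True by blast
          then show False using inv(1)[OF dE] d(2) by simp
        qed
        ultimately have "\<psi> ` star w' = star u" using x by simp
        then have "\<phi> ` \<psi> ` star w' = star w" using w(2) by simp
        moreover have "\<phi> ` \<psi> ` star w' = (\<lambda>x. x) ` star w'"
          unfolding image_image by (rule image_cong[OF refl]) (simp add: star_def inv(1))
        ultimately have "w' = w" using inj_onD[OF inj_on_star] w(1) w'(1) by simp
        then show False using w'(2) by simp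
      qed
      then show ?thesis using True w'(1) by auto
    qed
  qed
  then obtain f where f: "\<And>v. v \<in> V \<Longrightarrow> f v \<in> V" "\<And>v. v \<in> V \<Longrightarrow> \<phi> ` star v = star (f v)"
    by metis
  have inc: "f v \<in> \<phi> e \<longleftrightarrow> v \<in> e" if "v \<in> V" "e \<in> E" for v e
  proof -
    have "f v \<in> \<phi> e \<longleftrightarrow> \<phi> e \<in> \<phi> ` star v"
      using f(2)[OF that(1)] inv(4)[OF that(2)] unfolding star_def by simp
    also have "\<dots> \<longleftrightarrow> e \<in> star v"
      by (rule inj_on_image_mem_iff[OF bij_betw_imp_inj_on[OF bij] that(2)])
        (simp add: star_def)
    finally show ?thesis using that unfolding star_def by simp
  qed
  have inj: "inj_on f V"
  proof (rule inj_onI)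
    fix u v assume uv: "u \<in> V" "v \<in> V" "f u = f v"
    then have "star u = star v" using inc unfolding star_def by metis
    then show "u = v" using inj_onD[OF inj_on_star] uv by blast
  qed
  have "finite V" using simple unfolding simple_graph_def by blast
  then have bf: "bij_betw f V V"
    using inj f(1) by (simp add: bij_betw_def endo_inj_surj image_subset_iff)
  have \<phi>_eq: "\<phi> e = f ` e" if e: "e \<in> E" for e
  proof -
    \<comment> \<open>One inclusion is enough, because both sides have two elements.\<close>
    have "f ` e \<subseteq> \<phi> e" using inc edge_V e by blast
    moreover have "card (f ` e) = card e"
      by (rule card_image) (use inj edge_V e in \<open>meson inj_on_subset subsetI\<close>)
    moreover have "card (\<phi> e) = 2" "card e = 2"
      using inv(4)[OF e] e simple unfolding simple_graph_def by blast+
    ultimately show ?thesis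
      by (metis card.infinite card_subset_eq zero_neq_numeral)
  qed
  have "{u, v} \<in> E \<longleftrightarrow> {f u, f v} \<in> E" if uv: "u \<in> V" "v \<in> V" for u v
  proof
    assume "{u, v} \<in> E"
    then show "{f u, f v} \<in> E" using \<phi>_eq[of "{u, v}"] inv(4)[of "{u, v}"] by simp
  next
    assume fuv: "{f u, f v} \<in> E"
    define e where "e = \<psi> {f u, f v}"
    have e: "e \<in> E" "\<phi> e = {f u, f v}" unfolding e_def using inv[OF fuv] by auto
    then have "f ` e = f ` {u, v}" using \<phi>_eq by simp
    then have "e = {u, v}"
      using inj_on_image_eq_iff[OF inj, of e "{u, v}"] edge_V e(1) uv by blast
    then show "{u, v} \<in> E" using e by simp
  qed
  then have "f \<in> aut V E" using bf unfolding aut_def by blast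
  then show thesis using that \<phi>_eq by blast
qed

section \<open>Determining sets of a graph and of its line graph\<close>

lemma aut_induces_line_graph_aut:
  assumes f: "f \<in> aut V E"
  shows "(`) f \<in> aut E (line_graph_edges E)"
proof -
  have bij: "bij_betw f V V"
    and adj: "\<And>u v. u \<in> V \<Longrightarrow> v \<in> V \<Longrightarrow> {u, v} \<in> E \<longleftrightarrow> {f u, f v} \<in> E"
    using f unfolding aut_def by blast+
  have inj: "inj_on f V" by (rule bij_betw_imp_inj_on[OF bij])
  have sub: "e \<subseteq> V" if "e \<in> E" for e using that simple unfolding simple_graph_def by blast
  have inj': "inj_on ((`) f) E"
    by (rule inj_onI) (use inj_on_image_eq_iff[OF inj] sub in blast)
  have "f ` e \<in> E" if e: "e \<in> E" for e
  proof -
    obtain u v where "e = {u, v}" "u \<in> V" "v \<in> V" using simple_graph_edge[OF simple e] by blast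
    then show ?thesis using adj[of u v] e by simp
  qed
  moreover have "finite E"
    using simple sub finite_subset[of E "Pow V"] unfolding simple_graph_def by blast
  ultimately have "bij_betw ((`) f) E E"
    using inj' by (simp add: bij_betw_def endo_inj_surj image_subset_iff)
  moreover have "e \<inter> e' \<noteq> {} \<longleftrightarrow> f ` e \<inter> f ` e' \<noteq> {}" if "e \<in> E" "e' \<in> E" for e e'
    using inj_on_image_Int[OF inj sub sub, OF that] by (metis image_is_empty)
  ultimately show ?thesis unfolding aut_line_graph_iff[OF empty_notin] by blast
qed

text \<open>Automorphisms of the line graph are exactly the induced ones, and an automorphism of the
  graph that fixes every edge is trivial. Hence fixing the edges of \<open>T\<close> has the same
  consequence on both sides.\<close>

lemma determining_iff:
  assumes exc: "\<not> graph_iso V E {1..4::nat} G1_edges" "\<not> graph_iso V E {1..4::nat} G2_edges"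
      "\<not> graph_iso V E {1..4::nat} G3_edges"
  shows "edge_determining V E T \<longleftrightarrow> vertex_determining E (line_graph_edges E) T"
proof
  assume T: "edge_determining V E T"
  show "vertex_determining E (line_graph_edges E) T"
    unfolding vertex_determining_def
  proof (intro conjI ballI impI)
    show "T \<subseteq> E" using T unfolding edge_determining_def by blast
    fix \<phi> e assume \<phi>: "\<phi> \<in> aut E (line_graph_edges E)" "\<forall>x\<in>T. \<phi> x = x" "e \<in> E"
    obtain f where f: "f \<in> aut V E" "\<And>e. e \<in> E \<Longrightarrow> \<phi> e = f ` e"
      using line_graph_aut_induced[OF \<phi>(1) exc] by blast
    have "\<forall>x\<in>T. f ` x = x" using f(2) \<phi>(2) \<open>T \<subseteq> E\<close> by (metis subsetD)
    then have "\<forall>x\<in>V. f x = x" using T f(1) unfolding edge_determining_def by blast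
    moreover have "e \<subseteq> V" using \<phi>(3) simple unfolding simple_graph_def by blast
    ultimately have "f ` e = e" by force
    then show "\<phi> e = e" using f(2) \<phi>(3) by simp
  qed
next
  assume T: "vertex_determining E (line_graph_edges E) T"
  show "edge_determining V E T"
    unfolding edge_determining_def
  proof (intro conjI ballI impI)
    show "T \<subseteq> E" using T unfolding vertex_determining_def by blast
    fix f v assume f: "f \<in> aut V E" "\<forall>e\<in>T. f ` e = e" "v \<in> V"
    have id: "\<forall>e\<in>E. f ` e = e"
      using T aut_induces_line_graph_aut[OF f(1)] f(2) unfolding vertex_determining_def by blast
    have bij: "bij_betw f V V" using f(1) unfolding aut_def by blast
    have fv: "f v \<in> V" using bij f(3) by (auto dest: bij_betwE)
    have "f v \<in> e \<longleftrightarrow> v \<in> e" if e: "e \<in> E" for e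
    proof -
      have "e \<subseteq> V" using e simple unfolding simple_graph_def by blast
      then have "f v \<in> f ` e \<longleftrightarrow> v \<in> e"
        by (rule inj_on_image_mem_iff[OF bij_betw_imp_inj_on[OF bij] f(3)])
      then show ?thesis using id e by simp
    qed
    \<comment> \<open>All edges being fixed, \<open>v\<close> and \<open>f v\<close> lie on the same
      edges, and stars separate vertices.\<close>
    then have "star (f v) = star v" unfolding star_def by blast
    then show "f v = v" using inj_onD[OF inj_on_star] fv f(3) by blast
  qed
qed

end

theorem theorem1:
  fixes V :: "'a set" and E :: "'a set set"
  assumes "simple_graph V E" and "connected_graph V E" and "card V \<ge> 3"
  shows "determining_index V E = determining_number E (line_graph_edges E)
     \<longleftrightarrow> \<not> graph_iso V E {1..4::nat} G1_edges
       \<and> \<not> graph_iso V E {1..4::nat} G2_edges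
       \<and> \<not> graph_iso V E {1..4::nat} G3_edges"
proof
  interpret connected_graph3 V E using assms by unfold_locales
  assume "\<not> graph_iso V E {1..4::nat} G1_edges
       \<and> \<not> graph_iso V E {1..4::nat} G2_edges
       \<and> \<not> graph_iso V E {1..4::nat} G3_edges"
  then show "determining_index V E = determining_number E (line_graph_edges E)"
    \<comment> \<open>The two \<open>LEAST\<close> expressions range over cardinalities of the same
      family of sets.\<close>
    unfolding determining_index_def determining_number_def using determining_iff by simp
next
  assume eq: "determining_index V E = determining_number E (line_graph_edges E)"
  have "\<not> graph_iso V E {1..4::nat} G1_edges"
  proof
    assume "graph_iso V E {1..4::nat} G1_edges"
    then obtain a b c d where d: "distinct [a, b, c, d]" and VE: "V = {a, b, c, d}"
      "E = {{a, b}, {b, c}, {b, d}, {c, d}}"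
      by (rule graph_iso_G1E[OF _ assms(1)])
    show False using determining_index_less_G1[OF d, folded VE] eq by simp
  qed
  moreover have "\<not> graph_iso V E {1..4::nat} G2_edges"
  proof
    assume "graph_iso V E {1..4::nat} G2_edges"
    then obtain a b c d where d: "distinct [a, b, c, d]" and VE: "V = {a, b, c, d}"
      "E = {{a, b}, {b, c}, {c, d}, {a, c}, {b, d}}"
      by (rule graph_iso_G2E[OF _ assms(1)])
    show False using determining_index_less_G2[OF d, folded VE] eq by simp
  qed
  moreover have "\<not> graph_iso V E {1..4::nat} G3_edges"
  proof
    assume "graph_iso V E {1..4::nat} G3_edges"
    then obtain a b c d where d: "distinct [a, b, c, d]" and VE: "V = {a, b, c, d}"
      "E = {{a, b}, {a, c}, {a, d}, {b, c}, {b, d}, {c, d}}"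
      by (rule graph_iso_G3E[OF _ assms(1)])
    show False using determining_index_less_G3[OF d, folded VE] eq by simp
  qed
  ultimately show "\<not> graph_iso V E {1..4::nat} G1_edges
       \<and> \<not> graph_iso V E {1..4::nat} G2_edges
       \<and> \<not> graph_iso V E {1..4::nat} G3_edges" by blast
qed

end
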